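(* Let $G$ be a finite graph with vertex set $V$ and let $\omega:V\to\mathbb{Z}_{>0}$ be a weight function. For each subset $W\subseteq V$, let $a_W(1),a_W(2),\dots$ be the unique real numbers (possibly negative) such that, as formal power series in $t$, $$(1+t)^{a_W(1)}(1+t^2)^{a_W(2)}(1+t^3)^{a_W(3)}\cdots = I_{(G|_W,\omega)}(t).$$ Then $$\overline{X}_{(G,\omega)} = \sum_{W\subseteq V} (-1)^{|V\setminus W|}\prod_{k\ge 1}(1+\overline{p}_k)^{a_W(k)}.$$
   Context: For $W\subseteq V$, $G|_W$ is the induced subgraph on $W$ (vertex set $W$, edges of $G$ with both endpoints in $W$), with weights $\omega$ restricted to $W$. An independent (stable) set is a set of vertices no two of which are adjacent. For $S\subseteq V$, $\omega(S)=\sum_{v\in S}\omega(v)$. The independence polynomial is $I_{(H,\omega)}(t)=\sum_{S} t^{\omega(S)}$, the sum over all independent sets $S$ of $H$ (including $\varnothing$). For real $a$, $(1+u)^a$ means the formal series $\sum_{i\ge0}\binom{a}{i}u^i$ with $\binom{a}{i}=a(a-1)\cdots(a-i+1)/i!$. A proper set coloring of $(G,\omega)$ is a map $\alpha$ assigning to each vertex a nonempty subset of $\mathbb{Z}_{>0}$ such that $\alpha(u)\cap\alpha(v)=\varnothing$ whenever $uv$ is an edge. The Kromatic symmetric function is $\overline{X}_{(G,\omega)}=\sum_\alpha\prod_{v\in V}\prod_{i\in\alpha(v)}x_i^{\omega(v)}$, summed over proper set colorings. For a partition $\lambda$, $\overline{p}_\lambda:=\overline{X}_{\overline{K_\lambda}}$,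 where $\overline{K_\lambda}$ is the edgeless graph whose vertex weights are the parts of $\lambda$; $\overline{p}_k$ denotes $\overline{p}_\lambda$ for the one-part partition $\lambda=(k)$. *)

theory Defs
  imports
    "HOL-Analysis.Analysis"
    "HOL-Library.Poly_Mapping"
    "HOL-Computational_Algebra.Computational_Algebra"
    "Graph_Theory.Graph_Theory"
begin

unbundle no vec_syntax

section \<open>Formal power series of unbounded degree in countably many variables\<close>

text \<open>
  A monomial is a finitely supported exponent vector \<open>nat \<Rightarrow>\<^sub>0 nat\<close>; a series is an arbitrary
  assignment of coefficients to monomials.
\<close>

typedef 'a mps = "UNIV :: ((nat \<Rightarrow>\<^sub>0 nat) \<Rightarrow> 'a) set"
  morphisms mcoeff Abs_mps ..

setup_lifting type_definition_mps

lemma mps_eqI: "(\<And>m. mcoeff f m = mcoeff g m) \<Longrightarrow> f = g"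
  by transfer auto

lemma finite_mon_splits: "finite {(p, q). p + q = (m :: nat \<Rightarrow>\<^sub>0 nat)}"
proof -
  let ?L = "{p. \<forall>i. Poly_Mapping.lookup p i \<le> Poly_Mapping.lookup m i}"
  let ?B = "{..Max (insert 0 (Poly_Mapping.lookup m ` Poly_Mapping.keys m))}"
  have "Poly_Mapping.lookup ` ?L \<subseteq>
      {f. \<forall>x. (x \<in> Poly_Mapping.keys m \<longrightarrow> f x \<in> ?B) \<and> (x \<notin> Poly_Mapping.keys m \<longrightarrow> f x = 0)}"
  proof clarsimp
    fix p x assume *: "\<forall>i. Poly_Mapping.lookup p i \<le> Poly_Mapping.lookup m i"
    show "(x \<in> Poly_Mapping.keys m \<longrightarrow>
             Poly_Mapping.lookup p x \<le> Max (insert 0 (Poly_Mapping.lookup m ` Poly_Mapping.keys m))) \<and>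
          (x \<notin> Poly_Mapping.keys m \<longrightarrow> Poly_Mapping.lookup p x = 0)"
    proof (intro conjI impI)
      assume "x \<in> Poly_Mapping.keys m"
      then have "Poly_Mapping.lookup m x
          \<le> Max (insert 0 (Poly_Mapping.lookup m ` Poly_Mapping.keys m))"
        by (intro Max_ge) auto
      with * show "Poly_Mapping.lookup p x
          \<le> Max (insert 0 (Poly_Mapping.lookup m ` Poly_Mapping.keys m))"
        using order_trans by blast
    next
      assume "x \<notin> Poly_Mapping.keys m"
      then show "Poly_Mapping.lookup p x = 0"
        using *[rule_format, of x] by (simp add: in_keys_iff)
    qed
  qed
  then have "finite (Poly_Mapping.lookup ` ?L)"
    by (rule finite_subset) (rule finite_set_of_finite_funs; simp)
  then have L: "finite ?L"
    by (rule finite_imageD) (auto intro!: inj_onI simp: Poly_Mapping.lookup_inject)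
  have "{(p, q). p + q = m} \<subseteq> ?L \<times> ?L"
    by (auto simp: lookup_add)
  then show ?thesis
    using L finite_subset by blast
qed

instantiation mps :: (comm_ring_1) comm_ring_1
begin

lift_definition zero_mps :: "'a mps" is "\<lambda>_. 0" .
lift_definition one_mps :: "'a mps" is "\<lambda>m. if m = 0 then 1 else 0" .
lift_definition plus_mps :: "'a mps \<Rightarrow> 'a mps \<Rightarrow> 'a mps" is "\<lambda>f g m. f m + g m" .
lift_definition minus_mps :: "'a mps \<Rightarrow> 'a mps \<Rightarrow> 'a mps" is "\<lambda>f g m. f m - g m" .
lift_definition uminus_mps :: "'a mps \<Rightarrow> 'a mps" is "\<lambda>f m. - f m" .
lift_definition times_mps :: "'a mps \<Rightarrow> 'a mps \<Rightarrow> 'a mps" is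
  "\<lambda>f g m. \<Sum>(p, q) | p + q = m. f p * g q" .

instance
proof
  fix f g h :: "'a mps"
  show "f * g * h = f * (g * h)"
  proof (rule mps_eqI)
    fix m
    let ?S = "\<lambda>m. {(p, q). p + q = (m :: nat \<Rightarrow>\<^sub>0 nat)}"
    have "mcoeff (f * g * h) m =
        (\<Sum>x\<in>?S m. \<Sum>y\<in>?S (fst x). mcoeff f (fst y) * mcoeff g (snd y) * mcoeff h (snd x))"
      by (simp add: times_mps.rep_eq case_prod_unfold sum_distrib_right)
    also have "\<dots> = (\<Sum>(x, y)\<in>(SIGMA x:?S m. ?S (fst x)).
        mcoeff f (fst y) * mcoeff g (snd y) * mcoeff h (snd x))"
      by (intro sum.Sigma ballI finite_mon_splits)
    also have "\<dots> = (\<Sum>(x, y)\<in>(SIGMA x:?S m. ?S (snd x)).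
        mcoeff f (fst x) * (mcoeff g (fst y) * mcoeff h (snd y)))"
      by (rule sum.reindex_bij_witness
          [where i = "\<lambda>((a, bc), (b, c)). ((a + b, c), (a, b))"
             and j = "\<lambda>((ab, c), (a, b)). ((a, b + c), (b, c))"])
        (auto simp: ac_simps)
    also have "\<dots> = (\<Sum>x\<in>?S m. \<Sum>y\<in>?S (snd x).
        mcoeff f (fst x) * (mcoeff g (fst y) * mcoeff h (snd y)))"
      by (intro sum.Sigma[symmetric] ballI finite_mon_splits)
    also have "\<dots> = mcoeff (f * (g * h)) m"
      by (simp add: times_mps.rep_eq case_prod_unfold sum_distrib_left)
    finally show "mcoeff (f * g * h) m = mcoeff (f * (g * h)) m" .
  qed
  show "f * g = g * f"
  proof (rule mps_eqI)
    fix m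
    show "mcoeff (f * g) m = mcoeff (g * f) m"
      unfolding times_mps.rep_eq
      by (rule sum.reindex_bij_witness[where i = prod.swap and j = prod.swap])
        (auto simp: ac_simps)
  qed
  show "1 * f = f"
  proof (rule mps_eqI)
    fix m
    have "mcoeff (1 * f) m = (\<Sum>(p, q)\<in>{(0, m)}. mcoeff 1 p * mcoeff f q)"
      unfolding times_mps.rep_eq
      by (rule sum.mono_neutral_right)
        (auto simp: finite_mon_splits one_mps.rep_eq split: if_splits)
    then show "mcoeff (1 * f) m = mcoeff f m"
      by (simp add: one_mps.rep_eq)
  qed
  show "(f + g) * h = f * h + g * h"
    by (rule mps_eqI)
      (simp add: times_mps.rep_eq plus_mps.rep_eq case_prod_unfold sum.distrib algebra_simps)
  show "(0 :: 'a mps) \<noteq> 1"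
    by (metis one_mps.rep_eq zero_mps.rep_eq zero_neq_one)
qed (transfer; simp add: ac_simps fun_eq_iff)+

end

text \<open>The topology of coefficientwise stabilisation, i.e. the product of discrete topologies.\<close>

instantiation mps :: (type) t2_space
begin

definition open_mps :: "'a mps set \<Rightarrow> bool" where
  "open U \<longleftrightarrow>
    (\<forall>f\<in>U. \<exists>M. finite M \<and> (\<forall>g. (\<forall>m\<in>M. mcoeff g m = mcoeff f m) \<longrightarrow> g \<in> U))"

instance
proof
  show "open (UNIV :: 'a mps set)"
    by (auto simp: open_mps_def)
next
  fix S T :: "'a mps set"
  assume S: "open S" and T: "open T"
  show "open (S \<inter> T)"
    unfolding open_mps_def
  proof
    fix f assume f: "f \<in> S \<inter> T"
    obtain M where M: "finite M" "\<forall>g. (\<forall>m\<in>M. mcoeff g m = mcoeff f m) \<longrightarrow> g \<in> S"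
      using S f by (auto simp: open_mps_def)
    obtain N where N: "finite N" "\<forall>g. (\<forall>m\<in>N. mcoeff g m = mcoeff f m) \<longrightarrow> g \<in> T"
      using T f by (auto simp: open_mps_def)
    show "\<exists>M. finite M \<and> (\<forall>g. (\<forall>m\<in>M. mcoeff g m = mcoeff f m) \<longrightarrow> g \<in> S \<inter> T)"
      using M N by (intro exI[of _ "M \<union> N"]) auto
  qed
next
  fix K :: "'a mps set set"
  assume "\<forall>S\<in>K. open S"
  then show "open (\<Union>K)"
    unfolding open_mps_def by (meson Union_iff)
next
  fix f g :: "'a mps"
  assume "f \<noteq> g"
  then obtain m where m: "mcoeff f m \<noteq> mcoeff g m"
    using mps_eqI by blast
  let ?U = "\<lambda>c. {h. mcoeff h m = c}"
  have "open (?U c)" for c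
    unfolding open_mps_def by (auto intro!: exI[of _ "{m}"])
  then show "\<exists>U V. open U \<and> open V \<and> f \<in> U \<and> g \<in> V \<and> U \<inter> V = {}"
    using m by (intro exI[of _ "?U (mcoeff f m)"] exI[of _ "?U (mcoeff g m)"]) auto
qed

end

lemma tendsto_mps_iff:
  "(F \<longlongrightarrow> f) net \<longleftrightarrow> (\<forall>m. \<forall>\<^sub>F x in net. mcoeff (F x) m = mcoeff f m)"
proof
  assume lim: "(F \<longlongrightarrow> f) net"
  show "\<forall>m. \<forall>\<^sub>F x in net. mcoeff (F x) m = mcoeff f m"
  proof
    fix m
    have "open {h. mcoeff h m = mcoeff f m}"
      unfolding open_mps_def by (auto intro!: exI[of _ "{m}"])
    from topological_tendstoD[OF lim this]
    show "\<forall>\<^sub>F x in net. mcoeff (F x) m = mcoeff f m" by simp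
  qed
next
  assume *: "\<forall>m. \<forall>\<^sub>F x in net. mcoeff (F x) m = mcoeff f m"
  show "(F \<longlongrightarrow> f) net"
  proof (rule topological_tendstoI)
    fix S assume "open S" "f \<in> S"
    then obtain M where M: "finite M" "\<forall>g. (\<forall>m\<in>M. mcoeff g m = mcoeff f m) \<longrightarrow> g \<in> S"
      unfolding open_mps_def by blast
    from M(1) * have "\<forall>\<^sub>F x in net. \<forall>m\<in>M. mcoeff (F x) m = mcoeff f m"
      by (simp add: eventually_ball_finite_distrib)
    then show "\<forall>\<^sub>F x in net. F x \<in> S"
      by eventually_elim (use M(2) in blast)
  qed
qed

lift_definition mps_const :: "'a :: zero \<Rightarrow> 'a mps" is "\<lambda>c m. if m = 0 then c else 0" .

lift_definition mps_var :: "nat \<Rightarrow> 'a :: zero_neq_one mps" is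
  "\<lambda>i m. if m = Poly_Mapping.single i 1 then 1 else 0" .

text \<open>
  \<open>one_plus_power u a\<close> is \<open>(1 + u)\<^sup>a\<close>. The series converges whenever \<open>u\<close> has zero constant term.
\<close>

definition one_plus_power :: "real mps \<Rightarrow> real \<Rightarrow> real mps" where
  "one_plus_power u a = suminf (\<lambda>i. mps_const (a gchoose i) * u ^ i)"


section \<open>Independence polynomial and Kromatic symmetric function\<close>

definition independent_set :: "('v, 'e) pre_digraph \<Rightarrow> 'v set \<Rightarrow> bool" where
  "independent_set G S \<longleftrightarrow> S \<subseteq> verts G \<and> (\<forall>u\<in>S. \<forall>v\<in>S. \<not> u \<rightarrow>\<^bsub>G\<^esub> v)"

definition independence_poly :: "('v, 'e) pre_digraph \<Rightarrow> ('v \<Rightarrow> nat) \<Rightarrow> real poly" where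
  "independence_poly G \<omega> = (\<Sum>S | independent_set G S. monom 1 (sum \<omega> S))"

text \<open>
  Color sets are finite because the monomial of an infinite color set is not defined. Colorings are
  \<^const>\<open>undefined\<close> off the vertex set, so that distinct functions are distinct colorings.
\<close>

definition proper_set_colorings :: "('v, 'e) pre_digraph \<Rightarrow> ('v \<Rightarrow> nat set) set" where
  "proper_set_colorings G =
    {\<alpha> \<in> verts G \<rightarrow>\<^sub>E {C. finite C \<and> C \<noteq> {} \<and> C \<subseteq> {0<..}}.
      \<forall>u v. u \<rightarrow>\<^bsub>G\<^esub> v \<longrightarrow> \<alpha> u \<inter> \<alpha> v = {}}"

definition kromatic :: "('v, 'e) pre_digraph \<Rightarrow> ('v \<Rightarrow> nat) \<Rightarrow> real mps" where
  "kromatic G \<omega> =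
    (\<Sum>\<^sub>\<infinity>\<alpha>\<in>proper_set_colorings G. \<Prod>v\<in>verts G. \<Prod>i\<in>\<alpha> v. mps_var i ^ \<omega> v)"

text \<open>A partition is given by the list of its parts.\<close>

definition edgeless_graph :: "nat \<Rightarrow> (nat, nat \<times> nat) pre_digraph" where
  "edgeless_graph n = \<lparr>verts = {..<n}, arcs = {}, tail = fst, head = snd\<rparr>"

definition pbar_partition :: "nat list \<Rightarrow> real mps" where
  "pbar_partition parts = kromatic (edgeless_graph (length parts)) (\<lambda>i. parts ! i)"

definition pbar :: "nat \<Rightarrow> real mps" where
  "pbar k = pbar_partition [k]"


section \<open>The exponents of an Euler-type product\<close>

text \<open>
  \<open>fps_binomial c oo fps_X ^ k\<close> is \<open>(1 + t\<^sup>k)\<^sup>c\<close>, and convergence of the infinite product is with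
  respect to the \<open>t\<close>-adic metric on \<^typ>\<open>real fps\<close>.
\<close>

definition is_exponent_seq :: "real fps \<Rightarrow> (nat \<Rightarrow> real) \<Rightarrow> bool" where
  "is_exponent_seq F a \<longleftrightarrow> (\<lambda>k. fps_binomial (a (Suc k)) oo fps_X ^ Suc k) has_prod F"

lemma fps_mult_binomial_nth:
  fixes Q :: "real fps"
  assumes "j \<le> Suc n"
  shows "(Q * (fps_binomial c oo fps_X ^ Suc n)) $ j = Q $ j + (if j = Suc n then Q $ 0 * c else 0)"
proof -
  let ?B = "fps_binomial c oo fps_X ^ Suc n :: real fps"
  have B: "?B $ i = (if i = 0 then 1 else if i = Suc n then c else 0)" if "i \<le> Suc n" for i
  proof -
    have "\<not> Suc n dvd i" if "0 < i" "i < Suc n"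
      using that by (auto dest: dvd_imp_le)
    with that show ?thesis
      by (auto simp: fps_nth_compose_X_power simp del: power_Suc)
  qed
  have "(Q * ?B) $ j = (\<Sum>i=0..j. Q $ i * ?B $ (j - i))"
    by (simp add: fps_mult_nth)
  also have "\<dots> = (\<Sum>i=0..j. (if i = j then Q $ j else 0)
                + (if i = 0 then (if j = Suc n then Q $ 0 * c else 0) else 0))"
    using assms by (intro sum.cong refl) (auto simp: B simp del: power_Suc)
  also have "\<dots> = Q $ j + (if j = Suc n then Q $ 0 * c else 0)"
    by (subst sum.distrib) simp
  finally show ?thesis .
qed

lemma is_exponent_seq_iff:
  fixes F :: "real fps"
  assumes "F $ 0 = 1"
  shows "is_exponent_seq F a \<longleftrightarrow>
    (\<forall>n. F $ Suc n = (\<Prod>k<n. fps_binomial (a (Suc k)) oo fps_X ^ Suc k) $ Suc n + a (Suc n))"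
proof -
  define B where "B k = fps_binomial (a (Suc k)) oo fps_X ^ Suc k" for k
  define P where "P n = (\<Prod>k<n. B k)" for n
  have PSuc: "P (Suc n) = P n * B n" for n
    unfolding P_def by (simp add: mult.commute)
  have P_nth: "P (Suc n) $ j = P n $ j + (if j = Suc n then P n $ 0 * a (Suc n) else 0)"
    if "j \<le> Suc n" for n j
    unfolding PSuc B_def using that by (rule fps_mult_binomial_nth)
  have P0: "P n $ 0 = 1" for n
    by (induction n) (simp_all add: P_nth, simp add: P_def)
  have stable: "P (n + d) $ j = P n $ j" if "j \<le> n" for n d j
    using that by (induction d) (simp_all add: P_nth)
  have step: "P (Suc n) $ Suc n = P n $ Suc n + a (Suc n)" for n
    by (simp add: P_nth P0)
  have "F \<noteq> 0"
    using assms by auto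
  then have "is_exponent_seq F a \<longleftrightarrow> (\<lambda>n. P (Suc n)) \<longlonglongrightarrow> F"
    unfolding is_exponent_seq_def B_def[symmetric] has_prod_def raw_has_prod_def P_def
      lessThan_Suc_atMost
    by simp
  also have "\<dots> \<longleftrightarrow> P \<longlonglongrightarrow> F"
    by (rule filterlim_sequentially_Suc)
  also have "\<dots> \<longleftrightarrow> (\<forall>j. \<forall>\<^sub>F n in sequentially. P n $ j = F $ j)"
    by (simp add: tendsto_fps_iff)
  also have "\<dots> \<longleftrightarrow> (\<forall>j. P j $ j = F $ j)"
  proof (intro all_cong1)
    fix j
    have *: "P n $ j = P j $ j" if "n \<ge> j" for n
      using stable[of j j "n - j"] that by simp
    have "(\<forall>\<^sub>F n in sequentially. P n $ j = F $ j)
        \<longleftrightarrow> (\<forall>\<^sub>F n in sequentially. P j $ j = F $ j)"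
      by (rule eventually_cong[OF eventually_ge_at_top[of j]]) (drule *, erule arg_cong)
    then show "(\<forall>\<^sub>F n in sequentially. P n $ j = F $ j) \<longleftrightarrow> P j $ j = F $ j"
      by simp
  qed
  also have "\<dots> \<longleftrightarrow> (\<forall>n. F $ Suc n = P n $ Suc n + a (Suc n))"
  proof
    assume "\<forall>j. P j $ j = F $ j"
    then have "P (Suc n) $ Suc n = F $ Suc n" for n by blast
    then show "\<forall>n. F $ Suc n = P n $ Suc n + a (Suc n)"
      by (simp add: step)
  next
    assume *: "\<forall>n. F $ Suc n = P n $ Suc n + a (Suc n)"
    show "\<forall>j. P j $ j = F $ j"
    proof
      fix j show "P j $ j = F $ j"
        using * by (cases j) (simp_all only: step P0 assms)
    qed
  qed
  finally show ?thesis
    unfolding P_def B_def .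
qed

lemma ex_exponent_seq:
  fixes F :: "real fps"
  assumes "F $ 0 = 1"
  shows "\<exists>a. is_exponent_seq F a"
proof -
  let ?P = "\<lambda>f n r. F $ Suc n = (\<Prod>k<n. fps_binomial (f k) oo fps_X ^ Suc k) $ Suc n + (r :: real)"
  have "\<exists>f. \<forall>n. ?P f n (f n)"
  proof (rule dependent_wellorder_choice)
    fix r :: real and f g :: "nat \<Rightarrow> real" and n :: nat
    assume "\<And>y. y < n \<Longrightarrow> f y = g y"
    then have "(\<Prod>k<n. fps_binomial (f k) oo fps_X ^ Suc k)
             = (\<Prod>k<n. fps_binomial (g k) oo fps_X ^ Suc k)"
      by (intro prod.cong) auto
    then show "?P f n r = ?P g n r" by simp
  next
    fix n f
    show "\<exists>r. ?P f n r" by (rule exI[of _ "F $ Suc n - (\<Prod>k<n. fps_binomial (f k) oo fps_X ^ Suc k) $ Suc n"]) simp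
  qed
  then obtain f where "\<forall>n. ?P f n (f n)" ..
  then have "is_exponent_seq F (\<lambda>n. f (n - 1))"
    by (simp add: is_exponent_seq_iff[OF assms] del: power_Suc)
  then show ?thesis by blast
qed

lemma exponent_seq_unique:
  fixes F :: "real fps"
  assumes "F $ 0 = 1" and a: "is_exponent_seq F a" and b: "is_exponent_seq F b" and "k \<ge> 1"
  shows "a k = b k"
proof -
  have "a (Suc n) = b (Suc n)" for n
  proof (induction n rule: less_induct)
    case (less n)
    then have "(\<Prod>k<n. fps_binomial (a (Suc k)) oo fps_X ^ Suc k)
             = (\<Prod>k<n. fps_binomial (b (Suc k)) oo fps_X ^ Suc k)"
      by (intro prod.cong) auto
    moreover have "F $ Suc n
        = (\<Prod>k<n. fps_binomial (a (Suc k)) oo fps_X ^ Suc k) $ Suc n + a (Suc n)"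
      using a is_exponent_seq_iff[OF assms(1)] by blast
    moreover have "F $ Suc n
        = (\<Prod>k<n. fps_binomial (b (Suc k)) oo fps_X ^ Suc k) $ Suc n + b (Suc n)"
      using b is_exponent_seq_iff[OF assms(1)] by blast
    ultimately show ?case by simp
  qed
  then show ?thesis
    using \<open>k \<ge> 1\<close> by (cases k) auto
qed

lemma independence_poly_nth_0:
  assumes "finite (verts H)" and "\<And>v. v \<in> verts H \<Longrightarrow> \<omega> v > 0"
  shows "fps_of_poly (independence_poly H \<omega>) $ 0 = 1"
proof -
  have fin: "finite {S. independent_set H S}"
    by (rule finite_subset[of _ "Pow (verts H)"]) (auto simp: independent_set_def assms(1))
  have zero: "sum \<omega> S = 0 \<longleftrightarrow> S = {}" if "independent_set H S" for S
  proof -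
    have "finite S" "\<forall>v\<in>S. \<omega> v > 0"
      using that assms finite_subset by (auto simp: independent_set_def)
    then show ?thesis by auto
  qed
  have "fps_of_poly (independence_poly H \<omega>) $ 0
      = (\<Sum>S | independent_set H S. if sum \<omega> S = 0 then 1 else 0)"
    by (simp add: independence_poly_def coeff_sum)
  also have "\<dots> = (\<Sum>S | independent_set H S. if S = {} then 1 else 0)"
    by (intro sum.cong refl) (simp only: mem_Collect_eq zero)
  also have "\<dots> = 1"
    using fin by (simp add: independent_set_def)
  finally show ?thesis .
qed

end

theory Submission
  imports Defs
begin

text \<open>
  Since \<open>1 + p\<^sub>k = \<Prod>\<^sub>i (1 + x\<^sub>i\<^sup>k)\<close>, exchanging the products over \<open>k\<close> and \<open>i\<close> turns
  \<open>\<Prod>\<^sub>k (1 + p\<^sub>k) ^ a\<^sub>W(k)\<close> into \<open>\<Prod>\<^sub>i I\<^sub>W(x\<^sub>i)\<close>, where \<open>I\<^sub>W\<close> is the independence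
  polynomial of \<open>G \<restriction> W\<close>. Choosing an independent set for each color \<open>i\<close>, this product enumerates
  the proper colorings of \<open>G \<restriction> W\<close> in which vertices may have no color at all, and
  inclusion-exclusion over \<open>W\<close> leaves those in which every vertex of \<open>G\<close> has a color.
\<close>

section \<open>Degrees of monomials and coefficients of series\<close>

definition mdeg :: "(nat \<Rightarrow>\<^sub>0 nat) \<Rightarrow> nat" where
  "mdeg m = (\<Sum>i\<in>Poly_Mapping.keys m. Poly_Mapping.lookup m i)"

lemma keys_add_nat:
  "Poly_Mapping.keys (p + q :: nat \<Rightarrow>\<^sub>0 nat) = Poly_Mapping.keys p \<union> Poly_Mapping.keys q"
  by (auto simp: in_keys_iff lookup_add)

lemma mdeg_add: "mdeg (p + q) = mdeg p + mdeg q"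
proof -
  have *: "mdeg r = (\<Sum>i\<in>Poly_Mapping.keys (p + q). Poly_Mapping.lookup r i)"
    if "Poly_Mapping.keys r \<subseteq> Poly_Mapping.keys (p + q)" for r
    unfolding mdeg_def using that by (intro sum.mono_neutral_left) (auto simp: in_keys_iff)
  show ?thesis
    using *[of p] *[of q] by (simp add: mdeg_def[of "p + q"] keys_add_nat lookup_add sum.distrib)
qed

lemma mdeg_eq_0_iff: "mdeg m = 0 \<longleftrightarrow> m = 0"
  by (auto simp: mdeg_def in_keys_iff intro!: poly_mapping_eqI)

lemma mdeg_single [simp]: "mdeg (Poly_Mapping.single i n) = n"
  by (cases "n = 0") (auto simp: mdeg_def)

lemma mcoeff_0 [simp]: "mcoeff 0 m = 0"
  by (simp add: zero_mps.rep_eq)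

lemma mcoeff_1: "mcoeff 1 m = (if m = 0 then 1 else 0)"
  by (simp add: one_mps.rep_eq)

lemma mcoeff_add [simp]: "mcoeff (f + g) m = mcoeff f m + mcoeff g m"
  by (simp add: plus_mps.rep_eq)

lemma mcoeff_diff [simp]: "mcoeff (f - g) m = mcoeff f m - mcoeff g m"
  by (simp add: minus_mps.rep_eq)

lemma mcoeff_sum [simp]: "mcoeff (sum f A) m = (\<Sum>x\<in>A. mcoeff (f x) m)"
  by (induction A rule: infinite_finite_induct) simp_all

lemma mcoeff_mult: "mcoeff (f * g) m = (\<Sum>(p, q) | p + q = m. mcoeff f p * mcoeff g q)"
  by (simp add: times_mps.rep_eq)

lemma mcoeff_mult_0 [simp]: "mcoeff (f * g) 0 = mcoeff f 0 * mcoeff g 0"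
proof -
  have "{(p, q). p + q = (0 :: nat \<Rightarrow>\<^sub>0 nat)} = {(0, 0)}"
    by (auto simp: poly_mapping_eq_iff fun_eq_iff lookup_add)
  then show ?thesis
    by (simp add: mcoeff_mult)
qed

lemma mcoeff_prod_0 [simp]: "mcoeff (prod f A) 0 = (\<Prod>x\<in>A. mcoeff (f x) 0)"
  by (induction A rule: infinite_finite_induct) (simp_all add: mcoeff_1)

lemma mcoeff_const_mult [simp]: "mcoeff (mps_const c * f) m = c * mcoeff f m"
proof -
  have "mcoeff (mps_const c * f) m = (\<Sum>(p, q)\<in>{(0, m)}. mcoeff (mps_const c) p * mcoeff f q)"
    unfolding mcoeff_mult
    by (rule sum.mono_neutral_right)
      (auto simp: finite_mon_splits mps_const.rep_eq split: if_splits)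
  then show ?thesis
    by (simp add: mps_const.rep_eq)
qed

section \<open>Binomial series with real exponent\<close>

lemma mcoeff_power_eq_0:
  assumes "mcoeff u 0 = 0" "mdeg m < i"
  shows "mcoeff (u ^ i) m = 0"
  using assms(2)
proof (induction i arbitrary: m)
  case (Suc i)
  have "mcoeff u p * mcoeff (u ^ i) q = 0" if "p + q = m" for p q
  proof (cases "p = 0")
    case False
    then have "mdeg q < i"
      using Suc.prems that by (auto simp: mdeg_add simp flip: mdeg_eq_0_iff)
    then show ?thesis
      by (simp add: Suc.IH)
  qed (simp add: assms)
  then show ?case
    by (auto simp: mcoeff_mult intro!: sum.neutral)
qed simp

text \<open>Since \<open>u\<close> has no constant term, \<open>u ^ i\<close> has no monomial of
  degree below \<open>i\<close>, so each coefficient of the binomial series stabilises. The bound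
  \<open>N\<close> is left free so that the finite sum can be extended when convenient.\<close>

lemma mcoeff_one_plus_power:
  assumes "mcoeff u 0 = 0" "mdeg m \<le> N"
  shows "mcoeff (one_plus_power u a) m = (\<Sum>i\<le>N. (a gchoose i) * mcoeff (u ^ i) m)"
proof -
  have stable: "(\<Sum>i<n. (a gchoose i) * mcoeff (u ^ i) m)
      = (\<Sum>i\<le>mdeg m. (a gchoose i) * mcoeff (u ^ i) m)" if "n > mdeg m" for m n
    using that by (intro sum.mono_neutral_right) (auto simp: mcoeff_power_eq_0[OF assms(1)] not_le)
  \<comment> \<open>The limit is built coefficient by coefficient; uniqueness of limits then
    identifies it with \<open>suminf\<close>.\<close>
  define L where "L = Abs_mps (\<lambda>m. \<Sum>i\<le>mdeg m. (a gchoose i) * mcoeff (u ^ i) m)"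
  have L: "mcoeff L m = (\<Sum>i\<le>mdeg m. (a gchoose i) * mcoeff (u ^ i) m)" for m
    by (simp add: L_def Abs_mps_inverse)
  have "(\<lambda>i. mps_const (a gchoose i) * u ^ i) sums L"
    unfolding sums_def tendsto_mps_iff
    by (auto simp: L intro!: eventually_mono[OF eventually_gt_at_top] stable)
  then have "one_plus_power u a = L"
    unfolding one_plus_power_def by (rule sums_unique[symmetric])
  then show ?thesis
    using stable[of m "Suc N"] assms(2) by (simp add: L lessThan_Suc_atMost)
qed

lemma mcoeff_one_plus_power_0 [simp]:
  assumes "mcoeff u 0 = 0"
  shows "mcoeff (one_plus_power u a) 0 = 1"
  using mcoeff_one_plus_power[OF assms, of 0 0 a] by (simp add: mcoeff_1 mdeg_def)

lemma one_plus_power_of_nat: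
  assumes "mcoeff u 0 = 0"
  shows "one_plus_power u (of_nat n) = (1 + u) ^ n"
proof (rule mps_eqI)
  fix m
  have *: "of_nat k = (mps_const (of_nat k) :: real mps)" for k
    by (induction k) (auto intro!: mps_eqI simp: mps_const.rep_eq mcoeff_1)
  \<comment> \<open>The bound must reach \<open>mdeg m\<close> to give the coefficient and
    \<open>n\<close> to contain the whole binomial theorem; terms beyond \<open>n\<close> vanish
    because \<open>n gchoose i\<close> does.\<close>
  have "mcoeff (one_plus_power u (of_nat n)) m
      = (\<Sum>i\<le>max n (mdeg m). (of_nat n gchoose i) * mcoeff (u ^ i) m)"
    by (rule mcoeff_one_plus_power[OF assms]) simp
  also have "\<dots> = (\<Sum>i\<le>n. of_nat (n choose i) * mcoeff (u ^ i) m)"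
    by (intro sum.mono_neutral_cong_right) (auto simp: binomial_gbinomial[symmetric])
  also have "\<dots> = mcoeff ((u + 1) ^ n) m"
    by (simp add: binomial_ring * )
  finally show "mcoeff (one_plus_power u (of_nat n)) m = mcoeff ((1 + u) ^ n) m"
    by (simp add: add.commute)
qed

lemma one_plus_power_zero [simp]: "one_plus_power 0 a = 1"
proof (rule mps_eqI)
  fix m
  have "mcoeff (one_plus_power 0 a) m = (\<Sum>i\<in>{0}. (a gchoose i) * mcoeff (0 ^ i) m)"
    unfolding mcoeff_one_plus_power[OF mcoeff_0 order_refl]
    by (intro sum.mono_neutral_right) (auto simp: power_0_left)
  then show "mcoeff (one_plus_power 0 a) m = mcoeff 1 m"
    by simp
qed

section \<open>Polynomial dependence on the exponent and multiplicativity in the base\<close>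

definition real_polynomial_fun :: "(real \<Rightarrow> real) \<Rightarrow> bool" where
  "real_polynomial_fun f \<longleftrightarrow> (\<exists>p. f = poly p)"

lemma real_polynomial_fun_const: "real_polynomial_fun (\<lambda>_. c)"
  unfolding real_polynomial_fun_def by (rule exI[of _ "[:c:]"]) auto

lemma real_polynomial_fun_mult:
  "real_polynomial_fun f \<Longrightarrow> real_polynomial_fun g \<Longrightarrow> real_polynomial_fun (\<lambda>x. f x * g x)"
  unfolding real_polynomial_fun_def by (fastforce simp flip: poly_mult)

lemma real_polynomial_fun_sum:
  "(\<And>i. i \<in> A \<Longrightarrow> real_polynomial_fun (f i)) \<Longrightarrow> real_polynomial_fun (\<lambda>x. \<Sum>i\<in>A. f i x)"
proof (induction A rule: infinite_finite_induct)
  case (insert i A)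
  then have "real_polynomial_fun (f i)" "real_polynomial_fun (\<lambda>x. \<Sum>i\<in>A. f i x)"
    by blast+
  then obtain p q where "f i = poly p" "(\<lambda>x. \<Sum>i\<in>A. f i x) = poly q"
    unfolding real_polynomial_fun_def by blast
  then show ?case
    using insert.hyps by (auto simp: real_polynomial_fun_def fun_eq_iff intro!: exI[of _ "p + q"])
qed (simp_all add: real_polynomial_fun_const)

lemma real_polynomial_fun_gchoose: "real_polynomial_fun (\<lambda>x. x gchoose i)"
proof -
  have "(\<lambda>x. x gchoose i) = poly (smult (inverse (fact i)) (\<Prod>j<i. [:- of_nat j, 1:]))"
    by (auto simp: gbinomial_prod_rev poly_prod field_simps lessThan_atLeast0)
  then show ?thesis
    unfolding real_polynomial_fun_def by blast
qed

text \<open>The difference of the two polynomials has every natural number as a root, hence is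
  zero.\<close>

lemma real_polynomial_fun_eqI:
  assumes "real_polynomial_fun f" "real_polynomial_fun g" "\<And>n. f (of_nat n) = g (of_nat n)"
  shows "f = g"
proof -
  obtain p q where pq: "f = poly p" "g = poly q"
    using assms by (auto simp: real_polynomial_fun_def)
  have "range real \<subseteq> {x. poly (p - q) x = 0}"
    using assms(3) pq by auto
  moreover have "infinite (range real)"
    by (simp add: finite_image_iff inj_on_def)
  ultimately have "p - q = 0"
    using poly_roots_finite infinite_super by blast
  then show ?thesis
    using pq by simp
qed

text \<open>The coefficient is a finite combination of the polynomials \<open>a gchoose i\<close>
  with weights independent of \<open>a\<close>.\<close>

lemma real_polynomial_fun_one_plus_power:
  assumes "mcoeff u 0 = 0"
  shows "real_polynomial_fun (\<lambda>a. mcoeff (one_plus_power u a) m)"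
  unfolding mcoeff_one_plus_power[OF assms order_refl]
  by (intro real_polynomial_fun_sum real_polynomial_fun_mult real_polynomial_fun_gchoose
      real_polynomial_fun_const)

text \<open>
  Each coefficient of either side is a polynomial in the exponent, so it suffices to compare the
  two sides at natural exponents.
\<close>

lemma one_plus_power_mult_base:
  assumes "mcoeff u 0 = 0" "mcoeff v 0 = 0"
  shows "one_plus_power u a * one_plus_power v a = one_plus_power ((1 + u) * (1 + v) - 1) a"
proof (rule mps_eqI)
  fix m
  have uv: "mcoeff ((1 + u) * (1 + v) - 1) 0 = 0"
    using assms by (simp add: mcoeff_1)
  have "(\<lambda>a. mcoeff (one_plus_power u a * one_plus_power v a) m)
      = (\<lambda>a. mcoeff (one_plus_power ((1 + u) * (1 + v) - 1) a) m)"
  proof (rule real_polynomial_fun_eqI)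
    show "real_polynomial_fun (\<lambda>a. mcoeff (one_plus_power u a * one_plus_power v a) m)"
      unfolding mcoeff_mult case_prod_unfold
      by (intro real_polynomial_fun_sum real_polynomial_fun_mult
          real_polynomial_fun_one_plus_power assms)
    show "mcoeff (one_plus_power u (of_nat n) * one_plus_power v (of_nat n)) m
        = mcoeff (one_plus_power ((1 + u) * (1 + v) - 1) (of_nat n)) m" for n
      by (simp add: one_plus_power_of_nat[OF uv] one_plus_power_of_nat assms power_mult_distrib)
  qed (rule real_polynomial_fun_one_plus_power[OF uv])
  then show "mcoeff (one_plus_power u a * one_plus_power v a) m
      = mcoeff (one_plus_power ((1 + u) * (1 + v) - 1) a) m"
    by (rule fun_cong)
qed

lemma one_plus_power_prod_base:
  assumes "\<And>i. i \<in> A \<Longrightarrow> mcoeff (f i) 0 = 0"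
  shows "one_plus_power ((\<Prod>i\<in>A. 1 + f i) - 1) a = (\<Prod>i\<in>A. one_plus_power (f i) a)"
  using assms
proof (induction A rule: infinite_finite_induct)
  case (insert i A)
  let ?P = "(\<Prod>i\<in>A. 1 + f i) - 1"
  \<comment> \<open>Every factor \<open>1 + f i\<close> has constant term 1, so \<open>?P\<close> is
    an admissible argument, and \<open>1 + ?P\<close> is the product again.\<close>
  have "mcoeff ?P 0 = 0"
    using insert.prems by (simp add: mcoeff_1)
  then have "one_plus_power (f i) a * one_plus_power ?P a
      = one_plus_power ((1 + f i) * (1 + ?P) - 1) a"
    using insert.prems by (intro one_plus_power_mult_base) auto
  then show ?case
    using insert by simp
qed simp_all

lemma mcoeff_minus_one_power_mult [simp]: "mcoeff ((- 1) ^ n * f) m = (- 1) ^ n * mcoeff f m"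
proof (induction n)
  case (Suc n)
  have "mcoeff (- g) m = - mcoeff g m" for g :: "'a mps"
    by (simp add: uminus_mps.rep_eq)
  with Suc show ?case
    by simp
qed simp

section \<open>Congruence of series up to a given monomial\<close>

text \<open>
  \<open>magree m f g\<close> is congruence modulo the ideal of series without monomials dividing \<open>m\<close>.
  Modulo this ideal only finitely many variables matter.
\<close>

definition magree :: "(nat \<Rightarrow>\<^sub>0 nat) \<Rightarrow> 'a mps \<Rightarrow> 'a mps \<Rightarrow> bool" where
  "magree m f g \<longleftrightarrow> (\<forall>p q. p + q = m \<longrightarrow> mcoeff f p = mcoeff g p)"

lemma magreeD: "magree m f g \<Longrightarrow> mcoeff f m = mcoeff g m"
  unfolding magree_def by (metis add.right_neutral)

lemma magree_refl: "magree m f f"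
  by (simp add: magree_def)

text \<open>The coefficient of a product at a divisor of \<open>m\<close> involves only coefficients
  of the factors at divisors of that divisor, which again divide \<open>m\<close>.\<close>

lemma magree_mult:
  assumes "magree m f f'" "magree m g g'"
  shows "magree m (f * g) (f' * g')"
proof -
  have "mcoeff f r * mcoeff g s = mcoeff f' r * mcoeff g' s" if "r + s + q = m" for q r s
  proof -
    from that have "r + (s + q) = m" "s + (r + q) = m"
      by (simp_all add: ac_simps)
    then show ?thesis
      using assms unfolding magree_def by metis
  qed
  then show ?thesis
    by (auto simp: magree_def mcoeff_mult intro!: sum.cong)
qed

lemma magree_prod: "(\<And>i. i \<in> A \<Longrightarrow> magree m (f i) (g i)) \<Longrightarrow> magree m (prod f A) (prod g A)"
  by (induction A rule: infinite_finite_induct) (auto intro: magree_refl magree_mult)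

lemma magree_power: "magree m f g \<Longrightarrow> magree m (f ^ n) (g ^ n)"
  by (induction n) (auto intro: magree_refl magree_mult)

lemma magree_one_plus_power:
  assumes "magree m u v" "mcoeff u 0 = 0" "mcoeff v 0 = 0"
  shows "magree m (one_plus_power u a) (one_plus_power v a)"
  using magree_power[OF assms(1)]
  by (simp add: magree_def mcoeff_one_plus_power[OF assms(2) order_refl]
      mcoeff_one_plus_power[OF assms(3) order_refl])

section \<open>Substituting a variable into a one-variable series\<close>

text \<open>The substitution \<open>F(x\<^sub>i)\<close>.\<close>

definition fps_to_mps :: "nat \<Rightarrow> 'a :: comm_ring_1 fps \<Rightarrow> 'a mps" where
  "fps_to_mps i F =
    Abs_mps (\<lambda>m. if Poly_Mapping.keys m \<subseteq> {i} then F $ Poly_Mapping.lookup m i else 0)"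

lemma mcoeff_fps_to_mps:
  "mcoeff (fps_to_mps i F) m
    = (if Poly_Mapping.keys m \<subseteq> {i} then F $ Poly_Mapping.lookup m i else 0)"
  by (simp add: fps_to_mps_def Abs_mps_inverse)

lemma eq_single_iff:
  "m = Poly_Mapping.single i n \<longleftrightarrow> Poly_Mapping.keys m \<subseteq> {i} \<and> Poly_Mapping.lookup m i = n"
  by (auto simp: poly_mapping_eq_iff fun_eq_iff lookup_single in_keys_iff subset_iff when_def)

lemma fps_to_mps_1 [simp]: "fps_to_mps i 1 = 1"
  using eq_single_iff[of _ i 0] by (intro mps_eqI) (auto simp: mcoeff_fps_to_mps mcoeff_1)

lemma fps_to_mps_sum: "fps_to_mps i (sum F A) = (\<Sum>x\<in>A. fps_to_mps i (F x))"
  by (rule mps_eqI) (simp add: mcoeff_fps_to_mps fps_sum_nth)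

text \<open>A power of x_i splits only into powers of x_i, so the convolution becomes the Cauchy
  product. If \<open>m\<close> contains another variable, so does one factor of every splitting, and
  both sides vanish.\<close>

lemma fps_to_mps_mult: "fps_to_mps i (F * G) = fps_to_mps i F * fps_to_mps i G"
proof (rule mps_eqI)
  fix m
  show "mcoeff (fps_to_mps i (F * G)) m = mcoeff (fps_to_mps i F * fps_to_mps i G) m"
  proof (cases "Poly_Mapping.keys m \<subseteq> {i}")
    case True
    define n where "n = Poly_Mapping.lookup m i"
    have m: "m = Poly_Mapping.single i n"
      using True by (simp add: eq_single_iff n_def)
    have split: "Poly_Mapping.keys p \<subseteq> {i}" "Poly_Mapping.keys q \<subseteq> {i}"
      "Poly_Mapping.lookup p i + Poly_Mapping.lookup q i = n" if "p + q = m" for p q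
      using that True by (auto simp: keys_add_nat n_def lookup_add)
    have "mcoeff (fps_to_mps i F * fps_to_mps i G) m
        = (\<Sum>(p, q) | p + q = m. F $ Poly_Mapping.lookup p i * G $ Poly_Mapping.lookup q i)"
      unfolding mcoeff_mult by (intro sum.cong) (auto simp: mcoeff_fps_to_mps split)
    also have "\<dots> = (\<Sum>j=0..n. F $ j * G $ (n - j))"
    proof (rule sum.reindex_bij_witness[where
          i = "\<lambda>j. (Poly_Mapping.single i j, Poly_Mapping.single i (n - j))" and
          j = "\<lambda>(p, q). Poly_Mapping.lookup p i"])
      fix pq assume "pq \<in> {(p, q). p + q = m}"
      then obtain p q where pq: "pq = (p, q)" "p + q = m" by blast
      have "p = Poly_Mapping.single i (Poly_Mapping.lookup p i)"
        "q = Poly_Mapping.single i (Poly_Mapping.lookup q i)"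
        using split(1,2)[OF pq(2)] by (simp_all add: eq_single_iff)
      moreover have "Poly_Mapping.lookup q i = n - Poly_Mapping.lookup p i"
        using split(3)[OF pq(2)] by simp
      ultimately show "(Poly_Mapping.single i (case pq of (p, q) \<Rightarrow> Poly_Mapping.lookup p i),
          Poly_Mapping.single i (n - (case pq of (p, q) \<Rightarrow> Poly_Mapping.lookup p i))) = pq"
        using pq(1) by simp
    qed (auto simp: m single_add[symmetric] dest: split[unfolded m])
    finally show ?thesis
      using True by (simp add: mcoeff_fps_to_mps fps_mult_nth n_def)
  next
    case False
    then have "mcoeff (fps_to_mps i F * fps_to_mps i G) m = 0"
      unfolding mcoeff_mult by (intro sum.neutral) (auto simp: mcoeff_fps_to_mps keys_add_nat)
    with False show ?thesis
      by (simp add: mcoeff_fps_to_mps)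
  qed
qed

lemma fps_to_mps_prod: "fps_to_mps i (prod F A) = (\<Prod>x\<in>A. fps_to_mps i (F x))"
  by (induction A rule: infinite_finite_induct) (simp_all add: fps_to_mps_mult)

lemma fps_to_mps_X_power: "fps_to_mps i (fps_X ^ n) = mps_var i ^ n"
proof -
  have "fps_to_mps i fps_X = (mps_var i :: 'a mps)"
    by (rule mps_eqI) (auto simp: mcoeff_fps_to_mps mps_var.rep_eq fps_X_nth eq_single_iff)
  then show ?thesis
    by (induction n) (simp_all add: fps_to_mps_mult)
qed

lemma mcoeff_var_power:
  "mcoeff (mps_var i ^ n) m = (if m = Poly_Mapping.single i n then 1 else 0)"
  by (simp add: fps_to_mps_X_power[symmetric] mcoeff_fps_to_mps eq_single_iff)

lemma mcoeff_var_power_0: "n > 0 \<Longrightarrow> mcoeff (mps_var i ^ n) 0 = 0"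
  by (simp add: mcoeff_var_power eq_single_iff)

text \<open>Both sides have coefficient \<open>a gchoose j\<close> at the (k * j)-th power of x_i
  and 0 at all other monomials.\<close>

lemma fps_to_mps_binomial:
  assumes "k > 0"
  shows "fps_to_mps i (fps_binomial a oo fps_X ^ k) = one_plus_power (mps_var i ^ k) a"
proof (rule mps_eqI)
  fix m
  have *: "mcoeff (one_plus_power (mps_var i ^ k) a) m
      = (\<Sum>j\<le>mdeg m. (a gchoose j) * (if m = Poly_Mapping.single i (k * j) then 1 else 0))"
    by (simp add: mcoeff_one_plus_power[OF mcoeff_var_power_0[OF assms] order_refl]
        mcoeff_var_power flip: power_mult)
  show "mcoeff (fps_to_mps i (fps_binomial a oo fps_X ^ k)) m
      = mcoeff (one_plus_power (mps_var i ^ k) a) m"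
  proof (cases "\<exists>j. m = Poly_Mapping.single i (k * j)")
    case True
    then obtain j where j: "m = Poly_Mapping.single i (k * j)" by blast
    \<comment> \<open>As \<open>k > 0\<close>, the monomial determines \<open>j\<close>, and
      \<open>j\<close> lies in the summation range, whose bound \<open>mdeg m\<close> is
      \<open>k * j\<close>.\<close>
    have "Poly_Mapping.single i (k * j) = Poly_Mapping.single i (k * j') \<longleftrightarrow> j' = j" for j'
      using assms by (metis mdeg_single mult_cancel1 not_gr_zero)
    moreover have "j \<le> k * j"
      using assms by simp
    ultimately show ?thesis
      using assms unfolding *
      by (simp add: j if_distrib[of "\<lambda>x. _ * x"] cong: if_cong)
        (simp add: mcoeff_fps_to_mps fps_nth_compose_X_power)
  next
    case False
    then show ?thesis
      unfolding * by (auto simp: mcoeff_fps_to_mps fps_nth_compose_X_power eq_single_iff elim!: dvdE)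
  qed
qed

section \<open>Infinite sums of series and inclusion-exclusion for set colorings\<close>

text \<open>Each monomial receives contributions from finitely many summands, so partial sums
  stabilise coefficientwise. Finiteness is required at every monomial because the whole series must
  converge before one coefficient can be read off.\<close>

lemma mcoeff_infsum:
  fixes f :: "'b \<Rightarrow> 'a :: comm_ring_1 mps"
  assumes fin: "\<And>m. finite {x \<in> A. mcoeff (f x) m \<noteq> 0}"
    and B: "finite B" "B \<subseteq> A" "{x \<in> A. mcoeff (f x) m \<noteq> 0} \<subseteq> B"
  shows "mcoeff (infsum f A) m = (\<Sum>x\<in>B. mcoeff (f x) m)"
proof -
  define N where "N m = {x \<in> A. mcoeff (f x) m \<noteq> 0}" for m
  have sum_N: "(\<Sum>x\<in>B. mcoeff (f x) m) = (\<Sum>x\<in>N m. mcoeff (f x) m)"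
    if "finite B" "B \<subseteq> A" "N m \<subseteq> B" for B m
    using that by (intro sum.mono_neutral_right) (auto simp: N_def)
  define L where "L = Abs_mps (\<lambda>m. \<Sum>x\<in>N m. mcoeff (f x) m)"
  have L: "mcoeff L m = (\<Sum>x\<in>N m. mcoeff (f x) m)" for m
    by (simp add: L_def Abs_mps_inverse)
  have "(f has_sum L) A"
    unfolding has_sum_def tendsto_mps_iff
  proof
    fix m
    have "finite (N m)" "N m \<subseteq> A"
      using fin by (auto simp: N_def)
    then show "\<forall>\<^sub>F X in finite_subsets_at_top A. mcoeff (sum f X) m = mcoeff L m"
      unfolding eventually_finite_subsets_at_top mcoeff_sum L
      by (intro exI[of _ "N m"] conjI allI impI sum_N) auto
  qed
  then have "infsum f A = L"
    by (rule infsumI)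
  then show ?thesis
    using sum_N[of B m] B by (simp add: L N_def)
qed

text \<open>The sum is the expansion of the product of \<open>1 + ?g v\<close> over
  \<open>V\<close>, where \<open>?g\<close> is 0 on \<open>U\<close> and -1 off \<open>U\<close>.
  The zeros kill every \<open>W\<close> not containing \<open>U\<close>, and any vertex outside
  \<open>U\<close> makes the whole product vanish.\<close>

lemma sum_supersets_alternating:
  assumes "finite V" "U \<subseteq> V"
  shows "(\<Sum>W\<in>Pow V. if U \<subseteq> W then (- 1) ^ card (V - W) else 0)
    = (if U = V then 1 else 0 :: 'a :: comm_ring_1)"
proof -
  let ?g = "\<lambda>v. if v \<in> U then 0 else - 1 :: 'a"
  have "(\<Prod>v\<in>V - W. ?g v) = (if U \<subseteq> W then (- 1) ^ card (V - W) else 0)" if "W \<subseteq> V" for W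
  proof (cases "U \<subseteq> W")
    case True
    then have "(\<Prod>v\<in>V - W. ?g v) = (\<Prod>v\<in>V - W. - 1)"
      by (intro prod.cong) auto
    with True show ?thesis by simp
  next
    case False
    then show ?thesis
      using assms by (auto intro!: prod_zero)
  qed
  then have "(\<Sum>W\<in>Pow V. if U \<subseteq> W then (- 1) ^ card (V - W) else 0)
      = (\<Sum>W\<in>Pow V. (\<Prod>v\<in>W. 1) * (\<Prod>v\<in>V - W. ?g v))"
    by (intro sum.cong) auto
  also have "\<dots> = (\<Prod>v\<in>V. 1 + ?g v)"
    using assms by (simp add: prod_add)
  also have "\<dots> = (if U = V then 1 else 0)"
    using assms by (auto intro!: prod_zero prod.neutral)
  finally show ?thesis .
qed

text \<open>A coloring \<open>\<alpha>\<close> corresponds to the family of its color classes \<open>{v. i \<in> \<alpha> v}\<close>; these are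
  independent, and every vertex has a color iff they cover \<open>V\<close>.\<close>

lemma sum_colorings_eq:
  fixes x :: "nat \<Rightarrow> 'a :: comm_ring_1"
  assumes "wf_digraph G" "finite (verts G)" "finite K" "K \<subseteq> {0<..}"
  shows "(\<Sum>\<alpha> | \<alpha> \<in> proper_set_colorings G \<and> (\<forall>v\<in>verts G. \<alpha> v \<subseteq> K).
      \<Prod>v\<in>verts G. \<Prod>i\<in>\<alpha> v. x i ^ \<omega> v) =
    (\<Sum>W\<in>Pow (verts G). (- 1) ^ card (verts G - W) *
      (\<Prod>i\<in>K. \<Sum>S | independent_set G S \<and> S \<subseteq> W. x i ^ sum \<omega> S))"
proof -
  let ?V = "verts G"
  define Ind where "Ind = {S. independent_set G S}"
  define T where "T g = (\<Prod>i\<in>K. x i ^ sum \<omega> (g i))" for g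
  have Ind_V: "S \<subseteq> ?V" if "S \<in> Ind" for S
    using that by (auto simp: Ind_def independent_set_def)
  have fin_Ind: "finite Ind"
    by (rule finite_subset[of _ "Pow ?V"]) (use Ind_V assms in auto)
  have fin_PiE: "finite (K \<rightarrow>\<^sub>E Ind)"
    using assms fin_Ind by (intro finite_PiE) auto
  have "(\<Prod>i\<in>K. \<Sum>S | independent_set G S \<and> S \<subseteq> W. x i ^ sum \<omega> S)
      = (\<Sum>g\<in>K \<rightarrow>\<^sub>E Ind. if (\<Union>i\<in>K. g i) \<subseteq> W then T g else 0)" for W
  proof -
    have "(\<Prod>i\<in>K. \<Sum>S | independent_set G S \<and> S \<subseteq> W. x i ^ sum \<omega> S)
        = (\<Sum>g\<in>K \<rightarrow>\<^sub>E {S. independent_set G S \<and> S \<subseteq> W}. T g)"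
      unfolding T_def using assms fin_Ind
      by (intro prod_sum_PiE) (auto simp: Ind_def intro: finite_subset[rotated])
    \<comment> \<open>The dependence on \<open>W\<close> moves from the index set into the summand,
      so that the sums over \<open>W\<close> and \<open>g\<close> can be exchanged.\<close>
    also have "\<dots> = (\<Sum>g\<in>K \<rightarrow>\<^sub>E Ind. if (\<Union>i\<in>K. g i) \<subseteq> W then T g else 0)"
      using fin_PiE by (intro sum.mono_neutral_cong_left) (auto simp: Ind_def PiE_iff)
    finally show ?thesis .
  qed
  then have "(\<Sum>W\<in>Pow ?V. (- 1) ^ card (?V - W) *
        (\<Prod>i\<in>K. \<Sum>S | independent_set G S \<and> S \<subseteq> W. x i ^ sum \<omega> S))
      = (\<Sum>W\<in>Pow ?V. \<Sum>g\<in>K \<rightarrow>\<^sub>E Ind.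
          T g * (if (\<Union>i\<in>K. g i) \<subseteq> W then (- 1) ^ card (?V - W) else 0))"
    by (auto simp: sum_distrib_left mult.commute intro!: sum.cong)
  also have "\<dots> = (\<Sum>g\<in>K \<rightarrow>\<^sub>E Ind.
      T g * (\<Sum>W\<in>Pow ?V. if (\<Union>i\<in>K. g i) \<subseteq> W then (- 1) ^ card (?V - W) else 0))"
    by (subst sum.swap) (simp add: sum_distrib_left)
  \<comment> \<open>The signs cancel unless the color classes cover all vertices.\<close>
  also have "\<dots> = (\<Sum>g\<in>K \<rightarrow>\<^sub>E Ind. T g * (if (\<Union>i\<in>K. g i) = ?V then 1 else 0))"
    using Ind_V assms
    by (intro sum.cong refl arg_cong2[of _ _ _ _ "(*)"] sum_supersets_alternating)
      (auto simp: PiE_iff)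
  also have "\<dots> = (\<Sum>g | g \<in> K \<rightarrow>\<^sub>E Ind \<and> (\<Union>i\<in>K. g i) = ?V. T g)"
    using fin_PiE by (intro sum.mono_neutral_cong_right) auto
  also have "\<dots> = (\<Sum>\<alpha> | \<alpha> \<in> proper_set_colorings G \<and> (\<forall>v\<in>?V. \<alpha> v \<subseteq> K).
      \<Prod>v\<in>?V. \<Prod>i\<in>\<alpha> v. x i ^ \<omega> v)"
  proof (rule sum.reindex_bij_witness[where
        i = "\<lambda>\<alpha>. \<lambda>i\<in>K. {v \<in> ?V. i \<in> \<alpha> v}" and j = "\<lambda>g. \<lambda>v\<in>?V. {i \<in> K. v \<in> g i}"]; clarify)
    fix g assume g: "g \<in> K \<rightarrow>\<^sub>E Ind" "(\<Union>i\<in>K. g i) = ?V"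
    have gV: "g i \<subseteq> ?V" if "i \<in> K" for i
      using g that by blast
    show "(\<lambda>i\<in>K. {v \<in> ?V. i \<in> (\<lambda>v\<in>?V. {i \<in> K. v \<in> g i}) v}) = g"
      using g gV by (intro ext) (auto simp: PiE_iff extensional_def restrict_def)
    \<comment> \<open>The constructed coloring is \<open>undefined\<close> off \<open>?V\<close>, so
      disjointness along an edge needs both ends to be vertices.\<close>
    have adj: "u \<in> ?V \<and> v \<in> ?V" if "u \<rightarrow>\<^bsub>G\<^esub> v" for u v
      using wf_digraph.adj_in_verts[OF assms(1) that] by blast
    show "(\<lambda>v\<in>?V. {i \<in> K. v \<in> g i}) \<in> proper_set_colorings G \<and>
        (\<forall>v\<in>?V. (\<lambda>v\<in>?V. {i \<in> K. v \<in> g i}) v \<subseteq> K)"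
    proof (intro conjI ballI)
      show "(\<lambda>v\<in>?V. {i \<in> K. v \<in> g i}) \<in> proper_set_colorings G"
        unfolding proper_set_colorings_def
      proof (intro CollectI conjI allI impI)
        show "(\<lambda>v\<in>?V. {i \<in> K. v \<in> g i}) \<in> ?V \<rightarrow>\<^sub>E {C. finite C \<and> C \<noteq> {} \<and> C \<subseteq> {0<..}}"
          using g assms by (auto simp: PiE_iff)
        show "(\<lambda>v\<in>?V. {i \<in> K. v \<in> g i}) u \<inter> (\<lambda>v\<in>?V. {i \<in> K. v \<in> g i}) v = {}"
          if "u \<rightarrow>\<^bsub>G\<^esub> v" for u v
          using g that adj[OF that] by (auto simp: PiE_iff Ind_def independent_set_def)
      qed
    qed auto
    have "(\<Prod>v\<in>?V. \<Prod>i\<in>(\<lambda>v\<in>?V. {i \<in> K. v \<in> g i}) v. x i ^ \<omega> v)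
        = (\<Prod>v\<in>?V. \<Prod>i\<in>{i \<in> K. v \<in> g i}. x i ^ \<omega> v)"
      by simp
    \<comment> \<open>Both sides run over the pairs of a vertex and a color it carries; grouping by
      color adds the weights of each color class in the exponent.\<close>
    also have "\<dots> = (\<Prod>i\<in>K. \<Prod>v\<in>{v \<in> ?V. v \<in> g i}. x i ^ \<omega> v)"
      by (rule prod.swap_restrict) (use assms in auto)
    also have "\<dots> = T g"
      unfolding T_def using gV
      by (intro prod.cong refl) (simp add: Collect_conj_eq Int_absorb1 flip: power_sum)
    finally show "(\<Prod>v\<in>?V. \<Prod>i\<in>(\<lambda>v\<in>?V. {i \<in> K. v \<in> g i}) v. x i ^ \<omega> v) = T g" .
  next
    fix \<alpha> assume \<alpha>: "\<alpha> \<in> proper_set_colorings G" "\<forall>v\<in>?V. \<alpha> v \<subseteq> K"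
    then have \<alpha>_ext: "\<alpha> v = undefined" if "v \<notin> ?V" for v
      using that by (auto simp: proper_set_colorings_def PiE_iff extensional_def)
    show "(\<lambda>v\<in>?V. {i \<in> K. v \<in> (\<lambda>i\<in>K. {v \<in> ?V. i \<in> \<alpha> v}) i}) = \<alpha>"
      using \<alpha>(2) \<alpha>_ext by (intro ext) (auto simp: restrict_def)
    show "(\<lambda>i\<in>K. {v \<in> ?V. i \<in> \<alpha> v}) \<in> K \<rightarrow>\<^sub>E Ind \<and>
        (\<Union>i\<in>K. (\<lambda>i\<in>K. {v \<in> ?V. i \<in> \<alpha> v}) i) = ?V"
    proof
      show "(\<lambda>i\<in>K. {v \<in> ?V. i \<in> \<alpha> v}) \<in> K \<rightarrow>\<^sub>E Ind"
        using \<alpha>(1)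
        by (auto simp: Ind_def independent_set_def proper_set_colorings_def disjoint_iff)
      show "(\<Union>i\<in>K. (\<lambda>i\<in>K. {v \<in> ?V. i \<in> \<alpha> v}) i) = ?V"
        using \<alpha> by (fastforce simp: proper_set_colorings_def PiE_iff)
    qed
  qed
  finally show ?thesis ..
qed

section \<open>Coefficients of the Kromatic symmetric function\<close>

lemma mcoeff_eq_0_of_var_power_dvd:
  assumes "mps_var j ^ n dvd f" "n > 0" "j \<notin> Poly_Mapping.keys m"
  shows "mcoeff f m = 0"
proof -
  obtain g where g: "f = mps_var j ^ n * g"
    using assms(1) by blast
  have "mcoeff (mps_var j ^ n) p * mcoeff g q = 0" if "p + q = m" for p q
    using that assms by (auto simp: mcoeff_var_power keys_add_nat)
  then show ?thesis
    unfolding g mcoeff_mult by (intro sum.neutral) auto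
qed

text \<open>Weights are positive, so a coloring using a color i outside \<open>K\<close> contributes
  a multiple of x_i, which cannot reach \<open>m\<close>. The set \<open>K\<close> is left free so
  that one choice serves all divisors of a monomial.\<close>

lemma mcoeff_kromatic:
  assumes "finite (verts G)" "\<And>v. v \<in> verts G \<Longrightarrow> \<omega> v > 0"
    and "finite K" "Poly_Mapping.keys m \<inter> {0<..} \<subseteq> K"
  shows "mcoeff (kromatic G \<omega>) m =
    (\<Sum>\<alpha> | \<alpha> \<in> proper_set_colorings G \<and> (\<forall>v\<in>verts G. \<alpha> v \<subseteq> K).
      mcoeff (\<Prod>v\<in>verts G. \<Prod>i\<in>\<alpha> v. mps_var i ^ \<omega> v) m)"
proof -
  let ?C = "\<lambda>K. {\<alpha> \<in> proper_set_colorings G. \<forall>v\<in>verts G. \<alpha> v \<subseteq> K}"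
  let ?x = "\<lambda>\<alpha>. \<Prod>v\<in>verts G. \<Prod>i\<in>\<alpha> v. mps_var i ^ \<omega> v :: real mps"
  have fin: "finite (?C K)" if "finite K" for K
    by (rule finite_subset[of _ "verts G \<rightarrow>\<^sub>E Pow K"])
      (use assms(1) that in \<open>auto simp: proper_set_colorings_def intro!: PiE_I finite_PiE\<close>)
  have zero: "{\<alpha> \<in> proper_set_colorings G. mcoeff (?x \<alpha>) m \<noteq> 0} \<subseteq> ?C K"
    if "Poly_Mapping.keys m \<inter> {0<..} \<subseteq> K" for m K
  proof (clarify, rule ccontr)
    fix \<alpha> v i
    assume \<alpha>: "\<alpha> \<in> proper_set_colorings G" "mcoeff (?x \<alpha>) m \<noteq> 0"
      and v: "v \<in> verts G" "i \<in> \<alpha> v" "i \<notin> K"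
    have *: "finite (\<alpha> v)" "i > 0"
      using \<alpha>(1) v by (auto simp: proper_set_colorings_def PiE_iff)
    have "mps_var i ^ \<omega> v dvd (\<Prod>i\<in>\<alpha> v. mps_var i ^ \<omega> v :: real mps)"
      using v * by (intro dvd_prodI) auto
    also have "\<dots> dvd ?x \<alpha>"
      using v assms(1) by (intro dvd_prodI) auto
    finally have "mcoeff (?x \<alpha>) m = 0"
      by (rule mcoeff_eq_0_of_var_power_dvd) (use assms(2) v * that in auto)
    with \<alpha> show False by simp
  qed
  show ?thesis
    unfolding kromatic_def
  proof (rule mcoeff_infsum)
    show "finite {\<alpha> \<in> proper_set_colorings G. mcoeff (?x \<alpha>) m \<noteq> 0}" for m
      by (rule finite_subset[OF zero fin]) auto
  qed (use fin[OF assms(3)] zero[OF assms(4)] in auto)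
qed

lemma magree_kromatic:
  assumes "wf_digraph G" "finite (verts G)" "\<And>v. v \<in> verts G \<Longrightarrow> \<omega> v > 0"
    and "K = Poly_Mapping.keys m \<inter> {0<..}"
  shows "magree m (kromatic G \<omega>)
    (\<Sum>W\<in>Pow (verts G). (- 1) ^ card (verts G - W) *
      (\<Prod>i\<in>K. \<Sum>S | independent_set G S \<and> S \<subseteq> W. mps_var i ^ sum \<omega> S))"
proof -
  have K: "finite K" "K \<subseteq> {0<..}"
    using assms(4) by auto
  have "mcoeff (kromatic G \<omega>) p = mcoeff
      (\<Sum>\<alpha> | \<alpha> \<in> proper_set_colorings G \<and> (\<forall>v\<in>verts G. \<alpha> v \<subseteq> K).
        \<Prod>v\<in>verts G. \<Prod>i\<in>\<alpha> v. mps_var i ^ \<omega> v) p" if "p + q = m" for p q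
    unfolding mcoeff_sum
    by (rule mcoeff_kromatic) (use assms that in \<open>auto simp: keys_add_nat\<close>)
  then show ?thesis
    unfolding magree_def sum_colorings_eq[OF assms(1,2) K] by blast
qed

section \<open>Powers of \<open>1 + pbar k\<close> and their infinite product\<close>

text \<open>This is \<open>magree_kromatic\<close> for a single vertex of weight \<open>k\<close>:
  the empty subset contributes -1, and the full one contributes the product, each color being either
  absent or present.\<close>

lemma magree_pbar:
  assumes "k > 0" "K = Poly_Mapping.keys m \<inter> {0<..}"
  shows "magree m (pbar k) ((\<Prod>i\<in>K. 1 + mps_var i ^ k) - 1)"
proof -
  let ?E = "edgeless_graph (Suc 0)" and ?\<omega> = "\<lambda>i. [k] ! i"
  have V: "verts ?E = {0}"
    by (auto simp: edgeless_graph_def)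
  have ind: "independent_set ?E S \<longleftrightarrow> S \<subseteq> {0}" for S
    by (auto simp: independent_set_def edgeless_graph_def arcs_ends_def)
  have "magree m (kromatic ?E ?\<omega>) (\<Sum>W\<in>Pow (verts ?E). (- 1) ^ card (verts ?E - W) *
      (\<Prod>i\<in>K. \<Sum>S | independent_set ?E S \<and> S \<subseteq> W. mps_var i ^ sum ?\<omega> S))"
    by (rule magree_kromatic[OF _ _ _ assms(2)])
      (use assms in \<open>auto simp: V wf_digraph_def edgeless_graph_def\<close>)
  moreover have "{S. independent_set ?E S \<and> S \<subseteq> {}} = {{}}"
    "{S. independent_set ?E S \<and> S \<subseteq> {0}} = {{}, {0}}"
    by (auto simp: ind)
  ultimately show ?thesis
    by (simp add: pbar_def pbar_partition_def V Pow_insert)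
qed

lemma mcoeff_pbar_0: "k > 0 \<Longrightarrow> mcoeff (pbar k) 0 = 0"
  using magreeD[OF magree_pbar[of k _ 0]] by (simp add: mcoeff_1)

lemma magree_one_plus_power_pbar:
  assumes "k > 0" "K = Poly_Mapping.keys m \<inter> {0<..}"
  shows "magree m (one_plus_power (pbar k) a)
    (\<Prod>i\<in>K. fps_to_mps i (fps_binomial a oo fps_X ^ k))"
proof -
  have "magree m (one_plus_power (pbar k) a)
      (one_plus_power ((\<Prod>i\<in>K. 1 + mps_var i ^ k) - 1) a)"
    using assms by (intro magree_one_plus_power magree_pbar)
      (auto simp: mcoeff_1 mcoeff_pbar_0 mcoeff_var_power_0)
  then show ?thesis
    using assms by (simp add: one_plus_power_prod_base mcoeff_var_power_0 fps_to_mps_binomial)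
qed

text \<open>A power of x_i dividing \<open>m\<close> has exponent at most \<open>mdeg m\<close>.
  This turns t-adic approximation of \<open>F\<close> into coefficientwise approximation after
  substitution.\<close>

lemma mcoeff_prod_fps_to_mps_cong:
  assumes "\<And>n. n \<le> mdeg m \<Longrightarrow> F $ n = H $ n"
  shows "mcoeff (\<Prod>i\<in>K. fps_to_mps i F) m = mcoeff (\<Prod>i\<in>K. fps_to_mps i H) m"
proof (intro magreeD magree_prod)
  fix i
  have "F $ Poly_Mapping.lookup p i = H $ Poly_Mapping.lookup p i"
    if "p + q = m" "Poly_Mapping.keys p \<subseteq> {i}" for p q
  proof -
    have "p = Poly_Mapping.single i (Poly_Mapping.lookup p i)"
      using that(2) by (simp add: eq_single_iff)
    then have "mdeg p = Poly_Mapping.lookup p i"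
      by (metis mdeg_single)
    then show ?thesis
      using assms that(1) mdeg_add[of p q] by simp
  qed
  then show "magree m (fps_to_mps i F) (fps_to_mps i H)"
    unfolding magree_def mcoeff_fps_to_mps by auto
qed

text \<open>Up to \<open>m\<close>, a partial product over \<open>k\<close> is the product over the
  variables x_i of the corresponding partial Euler product of \<open>F\<close> evaluated at x_i, and
  the latter stabilises to \<open>F\<close>.\<close>

lemma mcoeff_prodinf_one_plus_power_pbar:
  assumes "is_exponent_seq F a" "F $ 0 = 1"
  shows "mcoeff (prodinf (\<lambda>k. one_plus_power (pbar (Suc k)) (a (Suc k)))) m
    = mcoeff (\<Prod>i\<in>Poly_Mapping.keys m \<inter> {0<..}. fps_to_mps i F) m"
proof -
  define b where "b k = fps_binomial (a (Suc k)) oo fps_X ^ Suc k" for k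
  define f where "f k = one_plus_power (pbar (Suc k)) (a (Suc k))" for k
  \<comment> \<open>The finite set of variables depends on the monomial, so the limit is given one
    coefficient at a time.\<close>
  define L where "L = Abs_mps (\<lambda>m. mcoeff (\<Prod>i\<in>Poly_Mapping.keys m \<inter> {0<..}. fps_to_mps i F) m)"
  have L: "mcoeff L m = mcoeff (\<Prod>i\<in>Poly_Mapping.keys m \<inter> {0<..}. fps_to_mps i F) m" for m
    by (simp add: L_def Abs_mps_inverse)
  have "F \<noteq> 0"
    using assms(2) by auto
  then have "(\<lambda>n. \<Prod>k\<le>n. b k) \<longlonglongrightarrow> F"
    using assms(1) by (simp add: is_exponent_seq_def has_prod_def raw_has_prod_def b_def)
  then have ev: "\<forall>\<^sub>F n in sequentially. (\<Prod>k\<le>n. b k) $ j = F $ j" for j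
    by (simp add: tendsto_fps_iff)
  have lim: "(\<lambda>n. \<Prod>k\<le>n. f k) \<longlonglongrightarrow> L"
    unfolding tendsto_mps_iff
  proof
    fix m :: "nat \<Rightarrow>\<^sub>0 nat"
    let ?K = "Poly_Mapping.keys m \<inter> {0<..}"
    have "magree m (\<Prod>k\<le>n. f k) (\<Prod>k\<le>n. \<Prod>i\<in>?K. fps_to_mps i (b k))" for n
      unfolding f_def b_def by (intro magree_prod magree_one_plus_power_pbar) auto
    \<comment> \<open>This exchanges the products over \<open>k\<close> and \<open>i\<close>, using
      that substitution commutes with finite products.\<close>
    moreover have "(\<Prod>k\<le>n. \<Prod>i\<in>?K. fps_to_mps i (b k))
        = (\<Prod>i\<in>?K. fps_to_mps i (\<Prod>k\<le>n. b k))" for n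
      by (simp add: fps_to_mps_prod prod.swap[of _ ?K])
    ultimately have *:
      "mcoeff (\<Prod>k\<le>n. f k) m = mcoeff (\<Prod>i\<in>?K. fps_to_mps i (\<Prod>k\<le>n. b k)) m" for n
      by (metis magreeD)
    have "\<forall>\<^sub>F n in sequentially. \<forall>j\<in>{..mdeg m}. (\<Prod>k\<le>n. b k) $ j = F $ j"
      using ev by (intro eventually_ball_finite) auto
    then show "\<forall>\<^sub>F n in sequentially. mcoeff (\<Prod>k\<le>n. f k) m = mcoeff L m"
      unfolding * L by eventually_elim (auto intro!: mcoeff_prod_fps_to_mps_cong)
  qed
  have "mcoeff L 0 = 1"
    by (simp add: L mcoeff_1)
  then have "L \<noteq> 0" by auto
  moreover have "f k \<noteq> 0" for k
    using mcoeff_one_plus_power_0[OF mcoeff_pbar_0, of "Suc k" "a (Suc k)"]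
    by (auto simp: f_def)
  \<comment> \<open>\<open>has_prod\<close> also allows the value 0 caused by a zero factor. As
    \<open>L\<close> and all \<open>f k\<close> are nonzero, only the limit \<open>L\<close>
    remains.\<close>
  ultimately have "f has_prod p \<longleftrightarrow> p = L" for p
    using lim LIMSEQ_unique[of "\<lambda>n. \<Prod>k\<le>n. f k"] by (auto simp: has_prod_def raw_has_prod_def)
  then have "prodinf f = L"
    by (simp add: prodinf_def)
  then show ?thesis
    by (simp add: L f_def[abs_def])
qed

section \<open>Independence polynomials of induced subgraphs and the final identity\<close>

lemma independent_set_induce_subgraph:
  assumes "W \<subseteq> verts G"
  shows "independent_set (G \<restriction> W) S \<longleftrightarrow> independent_set G S \<and> S \<subseteq> W"
  using assms by (auto simp: independent_set_def arcs_ends_conv) blast+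

lemma fps_to_mps_independence_poly:
  "fps_to_mps i (fps_of_poly (independence_poly G \<omega>))
    = (\<Sum>S | independent_set G S. mps_var i ^ sum \<omega> S)"
  by (simp add: independence_poly_def fps_of_poly_sum fps_of_poly_monom' fps_to_mps_sum
      fps_to_mps_X_power)

theorem theorem1p1:
  fixes G :: "('v, 'e) pre_digraph" and \<omega> :: "'v \<Rightarrow> nat" and a :: "'v set \<Rightarrow> nat \<Rightarrow> real"
  assumes "graph G"
    and "\<And>v. v \<in> verts G \<Longrightarrow> \<omega> v > 0"
    and "\<And>W. W \<subseteq> verts G \<Longrightarrow>
      is_exponent_seq (fps_of_poly (independence_poly (G \<restriction> W) \<omega>)) (a W)"
  shows "kromatic G \<omega> =
    (\<Sum>W\<in>Pow (verts G). (- 1) ^ card (verts G - W) *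
      prodinf (\<lambda>k. one_plus_power (pbar (Suc k)) (a W (Suc k))))"
proof (rule mps_eqI)
  fix m :: "nat \<Rightarrow>\<^sub>0 nat"
  interpret graph G by fact
  let ?K = "Poly_Mapping.keys m \<inter> {0<..}"
  \<comment> \<open>Evaluating the independence polynomial of \<open>G \<restriction> W\<close> at
    x_i sums over the independent sets of \<open>G\<close> inside \<open>W\<close>, which is exactly
    the factor for color i in \<open>magree_kromatic\<close>.\<close>
  have "mcoeff (prodinf (\<lambda>k. one_plus_power (pbar (Suc k)) (a W (Suc k)))) m
      = mcoeff (\<Prod>i\<in>?K. \<Sum>S | independent_set G S \<and> S \<subseteq> W. mps_var i ^ sum \<omega> S) m"
    if W: "W \<subseteq> verts G" for W
  proof -
    have "fps_of_poly (independence_poly (G \<restriction> W) \<omega>) $ 0 = 1"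
      using W assms(2) finite_subset[OF W finite_verts] by (intro independence_poly_nth_0) auto
    then show ?thesis
      using mcoeff_prodinf_one_plus_power_pbar[OF assms(3)[OF W]]
      by (simp add: fps_to_mps_independence_poly independent_set_induce_subgraph[OF W])
  qed
  then show "mcoeff (kromatic G \<omega>) m =
      mcoeff (\<Sum>W\<in>Pow (verts G). (- 1) ^ card (verts G - W) *
        prodinf (\<lambda>k. one_plus_power (pbar (Suc k)) (a W (Suc k)))) m"
    using magreeD[OF magree_kromatic[OF wf_digraph_axioms finite_verts assms(2) refl]]
    by (simp cong: sum.cong_simp)
qed

end
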